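(* Let $g_1,\dots,g_n$ be homogeneous forms in $\mathbb{R}[x_1,\dots,x_n]$ and let $j$ be an integer with $1\le j\le n-1$ such that $|x|^2=x_1^2+\dots+x_n^2\in\mathbb{R}[g_1,\dots,g_j]$. If $F$ is a homogeneous polynomial of the form \[F=A(g_1,\dots,g_j)+g_{j+1}B(g_1,\dots,g_j)\] for some polynomials $A,B\in\mathbb{R}[z_1,\dots,z_j]$, then $F$ is nonnegative on $\mathbb{R}^n$ if and only if $F$ is nonnegative on the real algebraic set in $\mathbb{R}^n$ defined by the vanishing of all maximal minors of the $n\times(j+1)$ matrix with columns $\nabla g_1,\dots,\nabla g_{j+1}$.
   Context: $\nabla g$ denotes the gradient (column vector of partial derivatives) of $g$. *)

theory Defs
  imports
    "HOL-Analysis.Analysis"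
    "HOL-Library.Poly_Mapping"
    "Jordan_Normal_Form.Determinant"
begin

text \<open>
  Real polynomials in variables \<open>'v\<close>: finitely supported maps from exponent vectors to
  coefficients, with the ring structure of \<^theory>\<open>HOL-Library.Poly_Mapping\<close>.
  The ring of polynomials in \<open>x\<^sub>1, \<dots>, x\<^sub>n\<close> is \<open>'n rpoly\<close> with \<open>'n\<close> finite
  of cardinality \<open>n\<close>; the ring of polynomials in \<open>z\<^sub>1, \<dots>, z\<^sub>j\<close> is the set
  \<open>rpolys_in {1..j}\<close> of elements of \<open>nat rpoly\<close>.
\<close>

type_synonym 'v rpoly = "('v \<Rightarrow>\<^sub>0 nat) \<Rightarrow>\<^sub>0 real"

definition Const :: "real \<Rightarrow> 'v rpoly" where
  "Const c = Poly_Mapping.single 0 c"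

definition Var :: "'v \<Rightarrow> 'v rpoly" where
  "Var v = Poly_Mapping.single (Poly_Mapping.single v 1) 1"

definition rpolys_in :: "'v set \<Rightarrow> 'v rpoly set" where
  "rpolys_in V = {p. \<forall>m\<in>Poly_Mapping.keys p. Poly_Mapping.keys m \<subseteq> V}"

definition mon_degree :: "('v \<Rightarrow>\<^sub>0 nat) \<Rightarrow> nat" where
  "mon_degree m = (\<Sum>v\<in>Poly_Mapping.keys m. Poly_Mapping.lookup m v)"

definition homogeneous :: "'v rpoly \<Rightarrow> bool" where
  "homogeneous p \<longleftrightarrow> (\<exists>d. \<forall>m\<in>Poly_Mapping.keys p. mon_degree m = d)"

text \<open>
  The ring homomorphism determined by \<open>c\<close> on coefficients and \<open>f\<close> on variables.
\<close>

definition rpoly_hom :: "(real \<Rightarrow> 'a::comm_ring_1) \<Rightarrow> ('v \<Rightarrow> 'a) \<Rightarrow> 'v rpoly \<Rightarrow> 'a" where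
  "rpoly_hom c f p =
    (\<Sum>m\<in>Poly_Mapping.keys p.
      c (Poly_Mapping.lookup p m) * (\<Prod>v\<in>Poly_Mapping.keys m. f v ^ Poly_Mapping.lookup m v))"

definition eval_at :: "real ^ 'n::finite \<Rightarrow> 'n rpoly \<Rightarrow> real" where
  "eval_at x p = rpoly_hom (\<lambda>c. c) (vec_nth x) p"

definition subst :: "('w \<Rightarrow> 'v rpoly) \<Rightarrow> 'w rpoly \<Rightarrow> 'v rpoly" where
  "subst g P = rpoly_hom Const g P"

text \<open>\<open>generated_subalgebra g j\<close> is the algebra generated by \<open>g 1, \<dots>, g j\<close>.\<close>

definition generated_subalgebra :: "(nat \<Rightarrow> 'v rpoly) \<Rightarrow> nat \<Rightarrow> 'v rpoly set" where
  "generated_subalgebra g j = subst g ` rpolys_in {1..j}"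

definition norm_sq_poly :: "'n::finite rpoly" where
  "norm_sq_poly = (\<Sum>i\<in>UNIV. Var i ^ 2)"

text \<open>
  If \<open>v\<close> does not occur in \<open>m\<close>, the truncated exponent is harmless because the coefficient
  vanishes.
\<close>

definition partial_deriv :: "'v \<Rightarrow> 'v rpoly \<Rightarrow> 'v rpoly" where
  "partial_deriv v p =
    (\<Sum>m\<in>Poly_Mapping.keys p.
      Poly_Mapping.single (m - Poly_Mapping.single v 1)
        (of_nat (Poly_Mapping.lookup m v) * Poly_Mapping.lookup p m))"

definition gradient :: "'n::finite rpoly \<Rightarrow> 'n rpoly ^ 'n" where
  "gradient p = (\<chi> i. partial_deriv i p)"

text \<open>
  The maximal minors of the matrix with \<open>k \<le> CARD('n)\<close> columns \<open>C 1, \<dots>, C k\<close>.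
  Since the row index type carries no order, a choice of \<open>k\<close> rows is an injective enumeration
  \<open>r\<close>; two enumerations of the same row set give the same minor up to sign.
\<close>

definition maximal_minors :: "nat \<Rightarrow> (nat \<Rightarrow> 'a::comm_ring_1 ^ 'n::finite) \<Rightarrow> 'a set" where
  "maximal_minors k C =
    {Determinant.det (Matrix.mat k k (\<lambda>(a, b). vec_nth (C (b + 1)) (r a))) | r. inj_on r {..<k}}"

definition real_zero_set :: "'n::finite rpoly set \<Rightarrow> (real ^ 'n) set" where
  "real_zero_set S = {x. \<forall>p\<in>S. eval_at x p = 0}"

definition nonneg_on :: "'n::finite rpoly \<Rightarrow> (real ^ 'n) set \<Rightarrow> bool" where
  "nonneg_on p X \<longleftrightarrow> (\<forall>x\<in>X. 0 \<le> eval_at x p)"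

end

theory Submission
  imports Defs
begin

text \<open>
  Fix a point \<open>a\<close> and let \<open>K\<close> be the common level set of \<open>g\<^sub>1, \<dots>, g\<^sub>j\<close> through \<open>a\<close>. Since
  \<open>|x|\<^sup>2\<close> is a polynomial in \<open>g\<^sub>1, \<dots>, g\<^sub>j\<close>, it is constant on \<open>K\<close>, so \<open>K\<close> is compact. On \<open>K\<close> the
  form \<open>F\<close> is an affine function of \<open>g\<^bsub>j+1\<^esub>\<close>, hence it attains its minimum over \<open>K\<close> at a point
  where \<open>g\<^bsub>j+1\<^esub>\<close> is extremal on \<open>K\<close>. There the gradients of \<open>g\<^sub>1, \<dots>, g\<^bsub>j+1\<^esub>\<close> are linearly
  dependent, since otherwise \<open>(g\<^sub>1, \<dots>, g\<^bsub>j+1\<^esub>)\<close> would be an open map near that point. So the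
  value of \<open>F\<close> at \<open>a\<close> is bounded below by its value at a point where all the minors vanish.
\<close>

section \<open>Nonvanishing minors and open maps\<close>

lemma has_derivative_vec_lambda:
  fixes f :: "'n::finite \<Rightarrow> 'a::real_normed_vector \<Rightarrow> real"
  assumes "\<And>i. (f i has_derivative f' i) F"
  shows "((\<lambda>x. \<chi> i. f i x) has_derivative (\<lambda>h. \<chi> i. f' i h)) F"
proof -
  have "((\<lambda>x. \<Sum>i\<in>UNIV. f i x *\<^sub>R axis i (1::real)) has_derivative
      (\<lambda>h. \<Sum>i\<in>UNIV. f' i h *\<^sub>R axis i 1)) F"
    by (intro derivative_intros assms)
  moreover have "(\<Sum>i\<in>UNIV. c i *\<^sub>R axis i (1::real)) = (\<chi> i. c i)" for c :: "'n \<Rightarrow> real"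
    by (simp add: Finite_Cartesian_Product.vec_eq_iff axis_def if_distrib[of "(*) _"] cong: if_cong)
  ultimately show ?thesis
    by simp
qed

lemma norm_axis_eq: "norm (axis i t :: real ^ 'n::finite) = \<bar>t\<bar>"
  by (simp add: norm_eq_sqrt_inner inner_axis_axis)

text \<open>A nonzero minor makes the \<open>k\<close> functions part of a coordinate system near
  \<open>x\<close>, so the value of \<open>f l\<close> can be moved both ways while the other values
  stay fixed.\<close>

lemma nonzero_minor_imp_fibre_varies:
  fixes f :: "nat \<Rightarrow> real ^ 'n::finite \<Rightarrow> real" and D :: "nat \<Rightarrow> real ^ 'n"
  assumes inj: "inj_on r {..<k}" and l: "l < k"
    and cont: "\<And>b. b < k \<Longrightarrow> continuous_on UNIV (f b)"
    and deriv: "\<And>b. b < k \<Longrightarrow>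
      (f b has_derivative (\<lambda>h. \<Sum>i\<in>UNIV. vec_nth (D b) i * vec_nth h i)) (at x)"
    and minor: "Determinant.det (Matrix.mat k k (\<lambda>(a, b). vec_nth (D b) (r a))) \<noteq> 0"
  obtains d where "0 < d"
    and "\<And>t. \<bar>t\<bar> < d \<Longrightarrow> \<exists>y. (\<forall>b<k. f b y = f b x + (if b = l then t else 0))"
proof -
  define R where "R = r ` {..<k}"
  define s where "s = inv_into {..<k} r"
  have s_r: "s (r b) = b" if "b < k" for b
    using inj that by (simp add: s_def)
  have s_less: "s i < k" if "i \<in> R" for i
    using that s_r by (auto simp: R_def)
  \<comment> \<open>Completing the \<open>k\<close> functions by the coordinates outside the chosen rows yields a local
    diffeomorphism of the whole space.\<close>
  define H where "H y = (\<chi> i. if i \<in> R then f (s i) y else vec_nth y i)" for y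
  define H' where "H' h = (\<chi> i. if i \<in> R then \<Sum>v\<in>UNIV. vec_nth (D (s i)) v * vec_nth h v
      else vec_nth h i)" for h :: "real ^ 'n"
  have H_r: "vec_nth (H y) (r b) = f b y" if "b < k" for y b
    using that s_r by (auto simp: H_def R_def)
  have H_deriv: "(H has_derivative H') (at x)"
    unfolding H_def H'_def
  proof (rule has_derivative_vec_lambda)
    show "((\<lambda>y. if i \<in> R then f (s i) y else vec_nth y i) has_derivative
      (\<lambda>h. if i \<in> R then \<Sum>v\<in>UNIV. vec_nth (D (s i)) v * vec_nth h v else vec_nth h i)) (at x)" for i
      using deriv[OF s_less]
      by (cases "i \<in> R") (simp_all add: bounded_linear_imp_has_derivative bounded_linear_vec_nth)
  qed
  have H_cont: "continuous_on UNIV H"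
    unfolding H_def
  proof (rule continuous_on_vec_lambda)
    show "continuous_on UNIV (\<lambda>y. if i \<in> R then f (s i) y else vec_nth y i)" for i
      using cont[OF s_less] by (cases "i \<in> R") (simp_all add: continuous_on_component)
  qed
  have lin: "linear H'"
    using H_deriv has_derivative_linear by blast
  \<comment> \<open>A vector in the kernel of \<open>H'\<close> vanishes off \<open>R\<close>; its
    entries along \<open>r\<close> form a vector \<open>w\<close> killed by the transposed minor, so
    they vanish too.\<close>
  have "inj H'"
    unfolding linear_injective_0[OF lin]
  proof (intro allI impI)
    fix h assume h: "H' h = 0"
    have off: "vec_nth h i = 0" if "i \<notin> R" for i
      using arg_cong[OF h, of "\<lambda>u. vec_nth u i"] that by (simp add: H'_def)
    define M where "M = Matrix.mat k k (\<lambda>(a, b). vec_nth (D b) (r a))"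
    define w where "w = Matrix.vec k (\<lambda>a. vec_nth h (r a))"
    have M: "M \<in> carrier_mat k k" and w: "w \<in> carrier_vec k"
      by (auto simp: M_def w_def)
    have sum: "(\<Sum>a<k. vec_nth (D b) (r a) * vec_nth h (r a)) = 0" if "b < k" for b
    proof -
      have "r b \<in> R"
        using that by (auto simp: R_def)
      then have "(\<Sum>v\<in>UNIV. vec_nth (D b) v * vec_nth h v) = 0"
        using arg_cong[OF h, of "\<lambda>u. vec_nth u (r b)"] s_r[OF that] by (simp add: H'_def)
      moreover have "(\<Sum>v\<in>UNIV. vec_nth (D b) v * vec_nth h v) =
          (\<Sum>v\<in>R. vec_nth (D b) v * vec_nth h v)"
        by (rule sum.mono_neutral_right) (auto simp: off)
      ultimately show ?thesis
        by (simp add: R_def sum.reindex[OF inj])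
    qed
    have "transpose_mat M *\<^sub>v w = 0\<^sub>v k"
      using sum by (intro eq_vecI) (auto simp: M_def w_def scalar_prod_def atLeast0LessThan)
    moreover have "Determinant.det (transpose_mat M) \<noteq> 0"
      using minor det_transpose[OF M] by (simp add: M_def)
    ultimately have "w = 0\<^sub>v k"
      using det_0_iff_vec_prod_zero[of "transpose_mat M" k] M w by auto
    then have "vec_nth h (r a) = 0" if "a < k" for a
      using that by (metis index_vec index_zero_vec(1) w_def)
    with off have "vec_nth h i = 0" for i
      by (cases "i \<in> R") (auto simp: R_def)
    then show "h = 0"
      by (simp add: Finite_Cartesian_Product.vec_eq_iff)
  qed
  then have "surj H'"
    by (rule linear_injective_imp_surjective[OF lin]) (rule refl)
  then obtain G where G: "linear G" "H' \<circ> G = id"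
    using linear_surjective_right_inverse[OF lin] by blast
  \<comment> \<open>Continuity of \<open>H\<close> and a right inverse of its derivative at the
    single point \<open>x\<close> suffice here.\<close>
  have "H x \<in> interior (H ` UNIV)"
    by (rule sussmann_open_mapping[OF open_UNIV H_cont _ H_deriv, of G UNIV])
      (use G in \<open>auto simp: linear_conv_bounded_linear\<close>)
  then obtain d where d: "0 < d" "ball (H x) d \<subseteq> H ` UNIV"
    by (auto simp: mem_interior)
  show thesis
  proof
    fix t :: real assume "\<bar>t\<bar> < d"
    then have "H x + axis (r l) t \<in> ball (H x) d"
      by (simp add: dist_norm norm_axis_eq)
    then obtain y where y: "H y = H x + axis (r l) t"
      using d by (metis imageE subsetD)
    have "f b y = f b x + (if b = l then t else 0)" if "b < k" for b
    proof -
      have "r b = r l \<longleftrightarrow> b = l"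
        using inj that l by (auto simp: inj_on_eq_iff)
      then show ?thesis
        using arg_cong[OF y, of "\<lambda>u. vec_nth u (r b)"] H_r[OF that] by (auto simp: axis_def)
    qed
    then show "\<exists>y. \<forall>b<k. f b y = f b x + (if b = l then t else 0)"
      by blast
  qed (fact d)
qed

section \<open>Evaluation at a point as a ring homomorphism\<close>

definition mon_eval :: "real ^ 'n::finite \<Rightarrow> ('n \<Rightarrow>\<^sub>0 nat) \<Rightarrow> real" where
  "mon_eval x m = (\<Prod>v\<in>UNIV. vec_nth x v ^ Poly_Mapping.lookup m v)"

lemma mon_eval_add: "mon_eval x (m + m') = mon_eval x m * mon_eval x m'"
  by (simp add: mon_eval_def lookup_add power_add prod.distrib)

text \<open>Indices outside the support contribute coefficient zero, and absent variables contribute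
  the factor 1. A common index set lets sums for different polynomials be compared termwise.\<close>

lemma eval_at_superset:
  assumes "finite S" and "Poly_Mapping.keys p \<subseteq> S"
  shows "eval_at x p = (\<Sum>m\<in>S. Poly_Mapping.lookup p m * mon_eval x m)"
proof -
  have "(\<Prod>v\<in>Poly_Mapping.keys m. vec_nth x v ^ Poly_Mapping.lookup m v) = mon_eval x m" for m
    unfolding mon_eval_def by (rule prod.mono_neutral_left) (auto simp: in_keys_iff)
  then show ?thesis
    unfolding eval_at_def rpoly_hom_def
    using assms by (auto simp: in_keys_iff intro!: sum.mono_neutral_left)
qed

lemma eval_at_single: "eval_at x (Poly_Mapping.single m c) = c * mon_eval x m"
  by (subst eval_at_superset[of "{m}"]) auto

lemma eval_at_add: "eval_at x (p + q) = eval_at x p + eval_at x q"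
proof -
  have "Poly_Mapping.keys (p + q) \<subseteq> Poly_Mapping.keys p \<union> Poly_Mapping.keys q"
    by (rule keys_add)
  then show ?thesis
    by (simp add: eval_at_superset[of "Poly_Mapping.keys p \<union> Poly_Mapping.keys q"]
        lookup_add distrib_right sum.distrib)
qed

lemma eval_at_zero: "eval_at x 0 = 0"
  by (simp add: eval_at_def rpoly_hom_def)

lemma eval_at_sum: "eval_at x (sum f S) = (\<Sum>i\<in>S. eval_at x (f i))"
  by (induction S rule: infinite_finite_induct) (auto simp: eval_at_zero eval_at_add)

lemma sum_singles_eq: "p = (\<Sum>m\<in>Poly_Mapping.keys p. Poly_Mapping.single m (Poly_Mapping.lookup p m))"
  by (rule poly_mapping_eqI)
    (auto simp: lookup_sum lookup_single when_def in_keys_iff)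

text \<open>By bilinearity this reduces to monomials, where it is
  \<open>mon_eval_add\<close>.\<close>

lemma eval_at_mult: "eval_at x (p * q) = eval_at x p * eval_at x q"
proof -
  have "eval_at x (p * q) = eval_at x
      ((\<Sum>m\<in>Poly_Mapping.keys p. Poly_Mapping.single m (Poly_Mapping.lookup p m)) *
       (\<Sum>m\<in>Poly_Mapping.keys q. Poly_Mapping.single m (Poly_Mapping.lookup q m)))"
    by (simp only: sum_singles_eq[symmetric])
  also have "\<dots> = eval_at x p * eval_at x q"
    by (simp add: sum_product mult_single eval_at_sum eval_at_single mon_eval_add
        eval_at_superset[OF finite_keys order_refl, of _ p]
        eval_at_superset[OF finite_keys order_refl, of _ q] mult_ac)
  finally show ?thesis .
qed

lemma eval_at_Const: "eval_at x (Const c) = c"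
  by (simp add: Const_def eval_at_single mon_eval_def)

text \<open>Makes evaluation commute with sums, products, powers and, for the minors,
  determinants.\<close>

interpretation eval_at: comm_ring_hom "eval_at x" for x :: "real ^ 'n::finite"
proof
  show "eval_at x 1 = 1"
    using eval_at_Const[of x 1] by (simp add: Const_def)
qed (auto simp: eval_at_zero eval_at_add eval_at_mult)

lemma eval_at_subst:
  "eval_at x (subst g P) = rpoly_hom (\<lambda>c. c) (\<lambda>i. eval_at x (g i)) P"
  by (simp add: subst_def rpoly_hom_def eval_at.hom_sum eval_at.hom_prod eval_at.hom_power
      eval_at_mult eval_at_Const)

text \<open>Used to see that elements of the generated subalgebra are constant on common level sets
  of the generators.\<close>

lemma eval_at_subst_cong:
  assumes "P \<in> rpolys_in V" and "\<And>i. i \<in> V \<Longrightarrow> eval_at x (g i) = eval_at y (g i)"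
  shows "eval_at x (subst g P) = eval_at y (subst g P)"
  using assms unfolding eval_at_subst rpoly_hom_def rpolys_in_def
  by (intro sum.cong prod.cong arg_cong2[where f = "(*)"] arg_cong2[where f = "(^)"] refl) auto

lemma eval_at_norm_sq_poly: "eval_at x norm_sq_poly = (norm x)\<^sup>2"
proof -
  have "eval_at x (Var i) = vec_nth x i" for i
  proof -
    have "mon_eval x (Poly_Mapping.single i 1) = (\<Prod>v\<in>UNIV. if v = i then vec_nth x v else 1)"
      unfolding mon_eval_def by (intro prod.cong) (auto simp: lookup_single when_def)
    then show ?thesis
      by (simp add: Var_def eval_at_single)
  qed
  then show ?thesis
    by (simp add: norm_sq_poly_def eval_at.hom_sum eval_at.hom_power norm_vec_def L2_set_def sum_nonneg)
qed

section \<open>Formal partial derivatives as analytic ones\<close>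

lemma mon_eval_has_derivative:
  "((\<lambda>y. mon_eval y m) has_derivative
    (\<lambda>h. \<Sum>i\<in>UNIV. real (Poly_Mapping.lookup m i) *
      mon_eval x (m - Poly_Mapping.single i 1) * vec_nth h i)) (at x)"
proof -
  have "((\<lambda>y. mon_eval y m) has_derivative
    (\<lambda>h. \<Sum>i\<in>UNIV. (of_nat (Poly_Mapping.lookup m i) * vec_nth h i *
        vec_nth x i ^ (Poly_Mapping.lookup m i - 1)) *
      (\<Prod>v\<in>UNIV - {i}. vec_nth x v ^ Poly_Mapping.lookup m v))) (at x)"
    unfolding mon_eval_def
    by (intro has_derivative_prod has_derivative_power
        bounded_linear_imp_has_derivative bounded_linear_vec_nth)
  \<comment> \<open>Subtraction truncates in the same way on both sides, so this holds even if
    \<open>i\<close> does not occur in \<open>m\<close>.\<close>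
  moreover have "mon_eval x (m - Poly_Mapping.single i 1) =
      vec_nth x i ^ (Poly_Mapping.lookup m i - 1) *
      (\<Prod>v\<in>UNIV - {i}. vec_nth x v ^ Poly_Mapping.lookup m v)" for i
    unfolding mon_eval_def
    by (subst prod.remove[of UNIV i]) (auto simp: lookup_minus lookup_single when_def intro!: prod.cong)
  ultimately show ?thesis
    by (simp add: mult_ac)
qed

lemma eval_at_has_derivative:
  "((\<lambda>y. eval_at y p) has_derivative
    (\<lambda>h. \<Sum>i\<in>UNIV. eval_at x (partial_deriv i p) * vec_nth h i)) (at x)"
proof -
  have "((\<lambda>y. \<Sum>m\<in>Poly_Mapping.keys p. Poly_Mapping.lookup p m * mon_eval y m) has_derivative
    (\<lambda>h. \<Sum>m\<in>Poly_Mapping.keys p. Poly_Mapping.lookup p m *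
      (\<Sum>i\<in>UNIV. real (Poly_Mapping.lookup m i) *
        mon_eval x (m - Poly_Mapping.single i 1) * vec_nth h i))) (at x)"
    by (intro has_derivative_sum has_derivative_mult_right mon_eval_has_derivative)
  moreover have "(\<Sum>m\<in>Poly_Mapping.keys p. Poly_Mapping.lookup p m *
      (\<Sum>i\<in>UNIV. real (Poly_Mapping.lookup m i) *
        mon_eval x (m - Poly_Mapping.single i 1) * vec_nth h i)) =
      (\<Sum>i\<in>UNIV. eval_at x (partial_deriv i p) * vec_nth h i)" for h
    unfolding partial_deriv_def eval_at_sum eval_at_single sum_distrib_left sum_distrib_right
    by (subst sum.swap) (simp add: mult_ac)
  ultimately show ?thesis
    by (simp add: eval_at_superset[OF finite_keys order_refl, of _ p])
qed

lemma continuous_on_eval_at: "continuous_on S (\<lambda>y. eval_at y p)"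
  by (intro continuous_at_imp_continuous_on ballI has_derivative_continuous[OF eval_at_has_derivative])

section \<open>Extrema on the level sets\<close>

text \<open>Were some minor nonzero at \<open>x\<close>, the last form could be moved in either
  direction along the fibre, so \<open>x\<close> would not be extremal. The sign of \<open>c\<close>
  treats minima and maxima at once.\<close>

lemma extremum_on_fibre_imp_minors_vanish:
  fixes g :: "nat \<Rightarrow> 'n::finite rpoly" and c :: real
  assumes "c \<noteq> 0"
    and min: "\<And>y. (\<And>i. i \<in> {1..j} \<Longrightarrow> eval_at y (g i) = eval_at x (g i)) \<Longrightarrow>
      c * eval_at x (g (j + 1)) \<le> c * eval_at y (g (j + 1))"
  shows "x \<in> real_zero_set (maximal_minors (j + 1) (\<lambda>i. gradient (g i)))"
proof (rule ccontr)
  assume "\<not> ?thesis"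
  then obtain r where inj: "inj_on r {..<j + 1}" and nz: "eval_at x (Determinant.det
      (Matrix.mat (j + 1) (j + 1) (\<lambda>(a, b). vec_nth (gradient (g (b + 1))) (r a)))) \<noteq> 0"
    by (auto simp: real_zero_set_def maximal_minors_def)
  \<comment> \<open>Matrix columns count from 0 and the forms from 1, so \<open>g (j + 1)\<close>
    belongs to column \<open>j\<close>.\<close>
  define D where "D b = (\<chi> i. eval_at x (partial_deriv i (g (b + 1))))" for b
  have minor: "Determinant.det (Matrix.mat (j + 1) (j + 1) (\<lambda>(a, b). vec_nth (D b) (r a))) \<noteq> 0"
  proof -
    have "map_mat (eval_at x)
        (Matrix.mat (j + 1) (j + 1) (\<lambda>(a, b). vec_nth (gradient (g (b + 1))) (r a))) =
        Matrix.mat (j + 1) (j + 1) (\<lambda>(a, b). vec_nth (D b) (r a))"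
      by (rule eq_matI) (auto simp: D_def gradient_def)
    then show ?thesis
      using nz by (simp flip: eval_at.hom_det)
  qed
  have deriv: "((\<lambda>y. eval_at y (g (b + 1))) has_derivative
      (\<lambda>h. \<Sum>i\<in>UNIV. vec_nth (D b) i * vec_nth h i)) (at x)" for b
    using eval_at_has_derivative[of "g (b + 1)" x] by (simp add: D_def)
  obtain d where "0 < d" and d: "\<And>t. \<bar>t\<bar> < d \<Longrightarrow>
      \<exists>y. (\<forall>b<j + 1. eval_at y (g (b + 1)) = eval_at x (g (b + 1)) + (if b = j then t else 0))"
    using nonzero_minor_imp_fibre_varies[OF inj _ continuous_on_eval_at deriv minor, of j]
    by (metis less_add_one)
  \<comment> \<open>A shift of sign opposite to \<open>c\<close> lowers \<open>c\<close> times the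
    last form; halving \<open>d\<close> keeps the shift admissible.\<close>
  define t where "t = - sgn c * (d / 2)"
  have "\<bar>t\<bar> < d" and "c * t < 0"
    using \<open>c \<noteq> 0\<close> \<open>0 < d\<close> by (auto simp: t_def sgn_if abs_mult mult_less_0_iff)
  obtain y where y: "\<And>b. b < j + 1 \<Longrightarrow>
      eval_at y (g (b + 1)) = eval_at x (g (b + 1)) + (if b = j then t else 0)"
    using d[OF \<open>\<bar>t\<bar> < d\<close>] by blast
  have "eval_at y (g i) = eval_at x (g i)" if "i \<in> {1..j}" for i
    using y[of "i - 1"] that by auto
  then have "c * eval_at x (g (j + 1)) \<le> c * eval_at y (g (j + 1))"
    by (rule min)
  with y[of j] \<open>c * t < 0\<close> show False
    by (simp add: distrib_left)
qed

text \<open>The fibre is closed, being cut out by continuous equations, and bounded, since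
  \<open>norm_sq_poly\<close> takes on it the value it has at \<open>a\<close>.\<close>

lemma compact_fibre:
  assumes "norm_sq_poly \<in> generated_subalgebra g j"
  shows "compact {x :: real ^ 'n::finite. \<forall>i\<in>{1..j}. eval_at x (g i) = eval_at a (g i)}"
    (is "compact ?K")
proof -
  obtain N where N: "N \<in> rpolys_in {1..j}" "norm_sq_poly = subst g N"
    using assms by (auto simp: generated_subalgebra_def)
  have "norm x \<le> norm a" if "x \<in> ?K" for x
  proof -
    have "eval_at x (subst g N) = eval_at a (subst g N)"
      using that by (intro eval_at_subst_cong[OF N(1)]) auto
    then show ?thesis
      by (simp flip: N(2) add: eval_at_norm_sq_poly)
  qed
  then have "bounded ?K"
    by (rule boundedI)
  moreover have "closed ?K"
  proof -
    have "closed (\<Inter>i\<in>{1..j}. {x. eval_at x (g i) = eval_at a (g i)})"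
      by (intro closed_INT ballI closed_Collect_eq continuous_on_eval_at continuous_on_const)
    also have "(\<Inter>i\<in>{1..j}. {x. eval_at x (g i) = eval_at a (g i)}) = ?K"
      by blast
    finally show ?thesis .
  qed
  ultimately show ?thesis
    by (simp add: compact_eq_bounded_closed)
qed

theorem theorem1p3:
  fixes g :: "nat \<Rightarrow> 'n::finite rpoly"
    and j :: nat
    and F :: "'n rpoly"
    and A B :: "nat rpoly"
  assumes "\<And>i. i \<in> {1..CARD('n)} \<Longrightarrow> homogeneous (g i)"
    and "1 \<le> j" and "j \<le> CARD('n) - 1"
    and "norm_sq_poly \<in> generated_subalgebra g j"
    and "homogeneous F"
    and "A \<in> rpolys_in {1..j}" and "B \<in> rpolys_in {1..j}"
    and "F = subst g A + g (j + 1) * subst g B"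
  shows "nonneg_on F UNIV \<longleftrightarrow>
    nonneg_on F (real_zero_set (maximal_minors (j + 1) (\<lambda>i. gradient (g i))))"
proof
  let ?Z = "real_zero_set (maximal_minors (j + 1) (\<lambda>i. gradient (g i)))"
  \<comment> \<open>The converse is restriction to a subset and is left to the closing
    \<open>qed\<close>.\<close>
  assume nonneg: "nonneg_on F ?Z"
  have "0 \<le> eval_at a F" for a
  proof -
    define K where "K = {x. \<forall>i\<in>{1..j}. eval_at x (g i) = eval_at a (g i)}"
    define \<beta> where "\<beta> = eval_at a (subst g B)"
    \<comment> \<open>If \<open>\<beta> = 0\<close> then \<open>F\<close> is constant on \<open>K\<close>, and any extremum of \<open>g (j + 1)\<close> will do.\<close>
    define c where "c = (if \<beta> = 0 then 1 else \<beta>)"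
    have F_K: "eval_at x F = eval_at a (subst g A) + \<beta> * eval_at x (g (j + 1))" if "x \<in> K" for x
    proof -
      have "eval_at x (subst g P) = eval_at a (subst g P)" if "P \<in> rpolys_in {1..j}" for P
        using \<open>x \<in> K\<close> by (intro eval_at_subst_cong[OF that]) (auto simp: K_def)
      then show ?thesis
        using assms by (simp add: eval_at_add eval_at_mult \<beta>_def mult.commute)
    qed
    have "a \<in> K"
      by (simp add: K_def)
    moreover have "compact K"
      unfolding K_def using assms(4) by (rule compact_fibre)
    ultimately obtain x where x: "x \<in> K"
      and min: "\<And>y. y \<in> K \<Longrightarrow> c * eval_at x (g (j + 1)) \<le> c * eval_at y (g (j + 1))"
      using continuous_attains_inf[of K "\<lambda>y. c * eval_at y (g (j + 1))"]
      by (metis continuous_on_eval_at continuous_on_mult_left empty_iff)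
    have "x \<in> ?Z"
    proof (rule extremum_on_fibre_imp_minors_vanish[of c])
      show "c \<noteq> 0"
        by (simp add: c_def)
      fix y assume "\<And>i. i \<in> {1..j} \<Longrightarrow> eval_at y (g i) = eval_at x (g i)"
      with x have "y \<in> K"
        by (auto simp: K_def)
      then show "c * eval_at x (g (j + 1)) \<le> c * eval_at y (g (j + 1))"
        by (rule min)
    qed
    with nonneg have "0 \<le> eval_at x F"
      by (simp add: nonneg_on_def)
    \<comment> \<open>If \<beta> is zero, both values of \<open>F\<close> agree by
      \<open>F_K\<close>; otherwise \<open>c\<close> is \<beta>, and minimality at \<open>x\<close>
      is the claim up to a common constant.\<close>
    also have "\<dots> \<le> eval_at a F"
      using min[OF \<open>a \<in> K\<close>] F_K[OF x] F_K[OF \<open>a \<in> K\<close>] by (simp add: c_def split: if_splits)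
    finally show ?thesis .
  qed
  then show "nonneg_on F UNIV"
    by (simp add: nonneg_on_def)
qed (simp add: nonneg_on_def)

end
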